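(* Let $K$ and $K'$ be (oriented, virtual) knots, i.e. one-component links. Then $M_A^{\mathrm{enr}}(K)\cong M_A^{\mathrm{enr}}(K')$ if and only if $\ker\varphi_K\cong\ker\varphi_{K'}$ as $\Lambda$-modules.
   Context: **Knot diagrams.** A knot diagram $D$ is an oriented virtual one-component link diagram in $\mathbb R^2$: an oriented, piecewise smooth closed curve with finitely many self-intersections, all transverse double points, each designated classical (with over/under information) or virtual. At each classical crossing the underpassing strand (only) is cut; nothing is cut at virtual crossings. The resulting pieces are the arcs; $A(D)$ is the set of arcs and $C(D)$ the set of classical crossings. Two diagrams are equivalent if related by a finite sequence of classical Reidemeister moves (involving only classical crossings) and detour moves (a segment with no classical crossing is replaced by any other piecewise smooth segment with the same endpoints and no classical crossing). A knot $K$ is an equivalence class of knot diagrams. **Crossing data.** For $c\in C(D)$: $a(c)$ is the overpassing arc, $b_1(c)$ the underpassing arc on the right-hand side of the oriented arc $a(c)$, and $b_2(c)$ the underpassing arc on its left-hand side. The writhe $w(c)$ is $+1$ if the underpassing strand is oriented from $b_1(c)$ to $b_2(c)$, and $-1$ if it is oriented from $b_2(c)$ to $b_1(c)$. **Reduced Alexander module.** $\Lambda=\mathbb Z[t,t^{-1}]$. $\varrho_D:\Lambda^{C(D)}\to\Lambda^{A(D)}$ is the $\Lambda$-linear map between free modules with $\varrho_D(c)=(1-t)a(c)+tb_1(c)-b_2(c)$. $M_A^{\mathrm{red}}(D)=\operatorname{coker}\varrho_D$, with quotient map $\varsigma_D:\Lambda^{A(D)}\to M_A^{\mathrm{red}}(D)$.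 $\varphi_D:M_A^{\mathrm{red}}(D)\to\Lambda$ is the $\Lambda$-linear map with $\varphi_D(\varsigma_D(a))=1$ for every $a\in A(D)$. **Peripheral elements.** The set of meridians is $M_1(D)=\{x\in M_A^{\mathrm{red}}(D)\mid\varphi_D(x)=1\}$. The longitude is $$\chi_1(D)=\varsigma_D\Big(\sum_{c\in C(D)}w(c)a(c)-\tfrac12\sum_{c\in C(D)}w(c)(b_1(c)+b_2(c))\Big),$$ where the second sum has all coefficients in $\{-2,0,2\}$ (each arc occurs $0$ or $2$ times as an underpassing arc), so multiplication by $\frac12$ makes sense. **Enhanced module.** $M_A^{\mathrm{enr}}(D)=(M_A^{\mathrm{red}}(D),M_1(D),\chi_1(D))$. An isomorphism $M_A^{\mathrm{enr}}(D)\to M_A^{\mathrm{enr}}(D')$ is a $\Lambda$-module isomorphism $f:M_A^{\mathrm{red}}(D)\to M_A^{\mathrm{red}}(D')$ with $f(M_1(D))=M_1(D')$ and $f(\chi_1(D))=\chi_1(D')$. Up to isomorphism these objects depend only on the knot $K$ represented by $D$; $M_A^{\mathrm{enr}}(K)$, $\varphi_K$, etc. mean $M_A^{\mathrm{enr}}(D)$, $\varphi_D$, etc. for any diagram $D$ of $K$. *)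

theory Defs
  imports
    "HOL-Analysis.Analysis"
    "HOL-Algebra.Algebraic_Closure_Type"
    "HOL-Algebra.AbelCoset"
    "HOL-Algebra.Module"
    "HOL-Library.Poly_Mapping"
begin

section \<open>Virtual knot diagrams\<close>

abbreviation S1 :: "complex set" where
  "S1 \<equiv> sphere 0 1"

text \<open>
  The plane is \<^typ>\<open>complex\<close>.  The closed curve is parametrized by the counterclockwise unit
  circle (values of \<open>curve\<close> off the circle are irrelevant), and \<open>under\<close> is the set of all
  parameters at which the curve underpasses at a classical crossing.  A double point is thus
  classical if one of its two parameters lies in \<open>under\<close> (the other one being overpassing), and
  virtual if neither does.
\<close>

record vdiagram =
  curve :: "complex \<Rightarrow> complex"
  under :: "complex set"

definition double_params :: "vdiagram \<Rightarrow> complex set" where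
  "double_params D = {z \<in> S1. \<exists>w \<in> S1. w \<noteq> z \<and> curve D w = curve D z}"

definition velocity :: "vdiagram \<Rightarrow> complex \<Rightarrow> complex" where
  "velocity D z = vector_derivative (\<lambda>s. curve D (z * cis s)) (at 0)"

text \<open>
  \<open>cross_product u v\<close> is the determinant of the pair \<open>(u, v)\<close> of plane vectors; it is positive iff
  \<open>v\<close> points to the left-hand side of \<open>u\<close>.
\<close>

definition cross_product :: "complex \<Rightarrow> complex \<Rightarrow> real" where
  "cross_product u v = Re u * Im v - Im u * Re v"

definition knot_diagram :: "vdiagram \<Rightarrow> bool" where
  "knot_diagram D \<longleftrightarrow>
     (\<lambda>s. curve D (cis s)) piecewise_C1_differentiable_on {0..2 * pi} \<and>
     finite (double_params D) \<and>
     (\<forall>x \<in> S1. \<forall>y \<in> S1. \<forall>z \<in> S1.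
        curve D x = curve D y \<and> curve D y = curve D z \<longrightarrow> x = y \<or> y = z \<or> x = z) \<and>
     (\<forall>z \<in> double_params D. (\<lambda>s. curve D (z * cis s)) differentiable (at 0)) \<and>
     (\<forall>z \<in> S1. \<forall>w \<in> S1. z \<noteq> w \<and> curve D z = curve D w \<longrightarrow>
        cross_product (velocity D z) (velocity D w) \<noteq> 0) \<and>
     under D \<subseteq> double_params D \<and>
     inj_on (curve D) (under D)"

text \<open>
  The arcs are recorded by their parameter sets: cutting the curve at the underpassings amounts to
  removing \<open>under D\<close> from the circle.
\<close>

definition arcs :: "vdiagram \<Rightarrow> complex set set" where
  "arcs D = components (S1 - under D)"

definition crossings :: "vdiagram \<Rightarrow> complex set" where
  "crossings D = curve D ` under D"

definition under_param :: "vdiagram \<Rightarrow> complex \<Rightarrow> complex" where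
  "under_param D c = (THE z. z \<in> under D \<and> curve D z = c)"

definition over_param :: "vdiagram \<Rightarrow> complex \<Rightarrow> complex" where
  "over_param D c = (THE z. z \<in> S1 - under D \<and> curve D z = c)"

definition over_arc :: "vdiagram \<Rightarrow> complex \<Rightarrow> complex set" where
  "over_arc D c = (THE x. x \<in> arcs D \<and> over_param D c \<in> x)"

definition under_arc_in :: "vdiagram \<Rightarrow> complex \<Rightarrow> complex set" where
  "under_arc_in D c =
     (THE x. x \<in> arcs D \<and> (\<forall>\<^sub>F s in at_left 0. under_param D c * cis s \<in> x))"

definition under_arc_out :: "vdiagram \<Rightarrow> complex \<Rightarrow> complex set" where
  "under_arc_out D c =
     (THE x. x \<in> arcs D \<and> (\<forall>\<^sub>F s in at_right 0. under_param D c * cis s \<in> x))"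

text \<open>The underpassing strand crosses the oriented overpassing strand from its right to its left.\<close>

definition right_to_left :: "vdiagram \<Rightarrow> complex \<Rightarrow> bool" where
  "right_to_left D c \<longleftrightarrow>
     cross_product (velocity D (over_param D c)) (velocity D (under_param D c)) > 0"

definition right_arc :: "vdiagram \<Rightarrow> complex \<Rightarrow> complex set" where
  "right_arc D c = (if right_to_left D c then under_arc_in D c else under_arc_out D c)"

definition left_arc :: "vdiagram \<Rightarrow> complex \<Rightarrow> complex set" where
  "left_arc D c = (if right_to_left D c then under_arc_out D c else under_arc_in D c)"

definition writhe :: "vdiagram \<Rightarrow> complex \<Rightarrow> int" where
  "writhe D c = (if right_to_left D c then 1 else - 1)"


section \<open>Virtual knots\<close>

text \<open>
  A curve in the plane is considered up to orientation-preserving reparametrization; \<open>h\<close> is a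
  lift to the real line of a homeomorphism of the circle.
\<close>

definition reparametrization :: "vdiagram \<Rightarrow> vdiagram \<Rightarrow> bool" where
  "reparametrization D D' \<longleftrightarrow>
     (\<exists>h :: real \<Rightarrow> real. continuous_on UNIV h \<and> strict_mono h \<and>
        (\<forall>s. h (s + 2 * pi) = h s + 2 * pi) \<and>
        (\<forall>s. curve D' (cis s) = curve D (cis (h s))) \<and>
        (\<forall>s. cis s \<in> under D' \<longleftrightarrow> cis (h s) \<in> under D))"

definition planar_isotopy :: "vdiagram \<Rightarrow> vdiagram \<Rightarrow> bool" where
  "planar_isotopy D D' \<longleftrightarrow>
     (\<exists>H :: real \<Rightarrow> complex \<Rightarrow> complex.
        continuous_on ({0..1} \<times> UNIV) (\<lambda>(s, p). H s p) \<and>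
        (\<forall>s \<in> {0..1}. \<exists>G. homeomorphism UNIV UNIV (H s) G) \<and>
        H 0 = id \<and>
        (\<forall>z \<in> S1. curve D' z = H 1 (curve D z)) \<and>
        under D' = under D)"

text \<open>A segment of the circle is given by the pair of its end angles.\<close>

definition is_segment :: "real \<times> real \<Rightarrow> bool" where
  "is_segment J \<longleftrightarrow> fst J < snd J \<and> snd J < fst J + 2 * pi"

definition seg :: "real \<times> real \<Rightarrow> complex set" where
  "seg J = cis ` {fst J..snd J}"

definition open_seg :: "real \<times> real \<Rightarrow> complex set" where
  "open_seg J = cis ` {fst J<..<snd J}"

definition classical_params :: "vdiagram \<Rightarrow> complex set" where
  "classical_params D = {z \<in> S1. curve D z \<in> crossings D}"

definition detour_move :: "vdiagram \<Rightarrow> vdiagram \<Rightarrow> bool" where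
  "detour_move D D' \<longleftrightarrow>
     (\<exists>J. is_segment J \<and>
        seg J \<inter> classical_params D = {} \<and> seg J \<inter> classical_params D' = {} \<and>
        (\<forall>z \<in> S1 - seg J. curve D' z = curve D z) \<and>
        under D' = under D)"

text \<open>
  \<open>tangle D \<Delta> Js\<close>: the part of \<open>D\<close> in the closed disc \<open>\<Delta>\<close> consists of the properly embedded strands
  \<open>Js\<close>, and all crossings in \<open>\<Delta>\<close> are classical and lie in its interior.
  \<open>agree_outside D D' Js\<close>: the diagrams coincide except on the strands \<open>Js\<close>.
\<close>

definition tangle :: "vdiagram \<Rightarrow> complex set \<Rightarrow> (real \<times> real) list \<Rightarrow> bool" where
  "tangle D \<Delta> Js \<longleftrightarrow>
     \<Delta> homeomorphic cball (0::complex) 1 \<and>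
     (\<forall>J \<in> set Js. is_segment J) \<and>
     (\<forall>i < length Js. \<forall>j < length Js. i \<noteq> j \<longrightarrow> seg (Js ! i) \<inter> seg (Js ! j) = {}) \<and>
     {z \<in> S1. curve D z \<in> \<Delta>} = (\<Union>J \<in> set Js. seg J) \<and>
     {z \<in> S1. curve D z \<in> interior \<Delta>} = (\<Union>J \<in> set Js. open_seg J) \<and>
     {z \<in> double_params D. curve D z \<in> \<Delta>} \<subseteq> classical_params D \<and>
     {z \<in> double_params D. curve D z \<in> \<Delta>} \<subseteq> (\<Union>J \<in> set Js. open_seg J)"

definition agree_outside :: "vdiagram \<Rightarrow> vdiagram \<Rightarrow> (real \<times> real) list \<Rightarrow> bool" where
  "agree_outside D D' Js \<longleftrightarrow>
     (\<forall>z \<in> S1 - (\<Union>J \<in> set Js. seg J).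
        curve D' z = curve D z \<and> (z \<in> under D' \<longleftrightarrow> z \<in> under D))"

definition no_crossing :: "vdiagram \<Rightarrow> (real \<times> real) list \<Rightarrow> bool" where
  "no_crossing D Js \<longleftrightarrow> inj_on (curve D) (\<Union>J \<in> set Js. seg J)"

text \<open>
  No strand crosses itself, any two different strands cross in exactly \<open>n\<close> points, and there the
  strand which comes first in the list is the overpassing one.
\<close>

definition layered :: "nat \<Rightarrow> vdiagram \<Rightarrow> (real \<times> real) list \<Rightarrow> bool" where
  "layered n D Js \<longleftrightarrow>
     (\<forall>J \<in> set Js. inj_on (curve D) (seg J)) \<and>
     (\<forall>i j. i < j \<and> j < length Js \<longrightarrow>
        card (curve D ` seg (Js ! i) \<inter> curve D ` seg (Js ! j)) = n \<and>
        (\<forall>z \<in> seg (Js ! i). \<forall>w \<in> seg (Js ! j). curve D z = curve D w \<longrightarrow> w \<in> under D))"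

text \<open>
  The three Reidemeister moves, in all orientations.  Up to isotopy of the disc \<open>\<Delta>\<close>, a strand with
  exactly one self-crossing is a kink, two simple strands with two common points form
  a bigon, and for three simple strands with prescribed ends which pairwise meet once there are
  exactly two configurations, exchanged by the third move.
\<close>

definition reidemeister1 :: "vdiagram \<Rightarrow> vdiagram \<Rightarrow> bool" where
  "reidemeister1 D D' \<longleftrightarrow>
     (\<exists>\<Delta> J. tangle D \<Delta> [J] \<and> tangle D' \<Delta> [J] \<and> agree_outside D D' [J] \<and>
        no_crossing D [J] \<and> card (crossings D' \<inter> \<Delta>) = 1)"

definition reidemeister2 :: "vdiagram \<Rightarrow> vdiagram \<Rightarrow> bool" where
  "reidemeister2 D D' \<longleftrightarrow>
     (\<exists>\<Delta> J\<^sub>1 J\<^sub>2. tangle D \<Delta> [J\<^sub>1, J\<^sub>2] \<and> tangle D' \<Delta> [J\<^sub>1, J\<^sub>2] \<and> agree_outside D D' [J\<^sub>1, J\<^sub>2] \<and>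
        no_crossing D [J\<^sub>1, J\<^sub>2] \<and> layered 2 D' [J\<^sub>1, J\<^sub>2])"

definition reidemeister3 :: "vdiagram \<Rightarrow> vdiagram \<Rightarrow> bool" where
  "reidemeister3 D D' \<longleftrightarrow>
     (\<exists>\<Delta> J\<^sub>1 J\<^sub>2 J\<^sub>3. tangle D \<Delta> [J\<^sub>1, J\<^sub>2, J\<^sub>3] \<and> tangle D' \<Delta> [J\<^sub>1, J\<^sub>2, J\<^sub>3] \<and>
        agree_outside D D' [J\<^sub>1, J\<^sub>2, J\<^sub>3] \<and>
        layered 1 D [J\<^sub>1, J\<^sub>2, J\<^sub>3] \<and> layered 1 D' [J\<^sub>1, J\<^sub>2, J\<^sub>3])"

definition diagram_move :: "vdiagram \<Rightarrow> vdiagram \<Rightarrow> bool" where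
  "diagram_move D D' \<longleftrightarrow> knot_diagram D \<and> knot_diagram D' \<and>
     (reparametrization D D' \<or> planar_isotopy D D' \<or> detour_move D D' \<or>
      reidemeister1 D D' \<or> reidemeister2 D D' \<or> reidemeister3 D D')"

definition diagram_equiv :: "(vdiagram \<times> vdiagram) set" where
  "diagram_equiv =
     {(D, D'). knot_diagram D \<and> knot_diagram D' \<and> equivclp diagram_move D D'}"

definition virtual_knots :: "vdiagram set set" where
  "virtual_knots = {D. knot_diagram D} // diagram_equiv"


section \<open>Modules over the Laurent polynomial ring\<close>

text \<open>
  \<open>\<int>[t, t\<^sup>-\<^sup>1]\<close> is the group ring of \<open>\<int>\<close>: the coefficient of \<open>t\<^sup>n\<close> is the value at \<open>n :: int\<close>, and
  multiplication is convolution.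
\<close>

type_synonym laurent = "int \<Rightarrow>\<^sub>0 int"

definition tvar :: laurent where
  "tvar = Poly_Mapping.single 1 1"

abbreviation Laurent :: "laurent ring" where
  "Laurent \<equiv> ring_of_type_algebra"

text \<open>For the finite sets \<open>A\<close> considered here, this is the free module with basis \<open>A\<close>.\<close>

definition free_module :: "'x set \<Rightarrow> (laurent, 'x \<Rightarrow> laurent) module" where
  "free_module A =
     \<lparr>carrier = {f. \<forall>x. x \<notin> A \<longrightarrow> f x = 0},
      monoid.mult = undefined, one = undefined,
      zero = (\<lambda>x. 0), add = (\<lambda>f g x. f x + g x),
      smult = (\<lambda>r f x. r * f x)\<rparr>"

definition quotient_module :: "('r, 'm) module \<Rightarrow> 'm set \<Rightarrow> ('r, 'm set) module" where
  "quotient_module M N =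
     \<lparr>carrier = A_RCOSETS M N,
      monoid.mult = undefined, one = undefined,
      zero = N, add = (\<lambda>A B. A <+>\<^bsub>M\<^esub> B),
      smult = (\<lambda>r A. \<Union>x \<in> A. N +>\<^bsub>M\<^esub> (r \<odot>\<^bsub>M\<^esub> x))\<rparr>"

definition module_homs ::
  "('r, 'a) ring_scheme \<Rightarrow> ('r, 'm) module \<Rightarrow> ('r, 'n) module \<Rightarrow> ('m \<Rightarrow> 'n) set" where
  "module_homs R M N =
     {f \<in> carrier M \<rightarrow> carrier N.
        (\<forall>x \<in> carrier M. \<forall>y \<in> carrier M. f (x \<oplus>\<^bsub>M\<^esub> y) = f x \<oplus>\<^bsub>N\<^esub> f y) \<and>
        (\<forall>r \<in> carrier R. \<forall>x \<in> carrier M. f (r \<odot>\<^bsub>M\<^esub> x) = r \<odot>\<^bsub>N\<^esub> f x)}"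

definition module_isos ::
  "('r, 'a) ring_scheme \<Rightarrow> ('r, 'm) module \<Rightarrow> ('r, 'n) module \<Rightarrow> ('m \<Rightarrow> 'n) set" where
  "module_isos R M N = {f \<in> module_homs R M N. bij_betw f (carrier M) (carrier N)}"

definition isomorphic_modules ::
  "('r, 'a) ring_scheme \<Rightarrow> ('r, 'm) module \<Rightarrow> ('r, 'n) module \<Rightarrow> bool" where
  "isomorphic_modules R M N \<longleftrightarrow> module_isos R M N \<noteq> {}"


section \<open>The enhanced reduced Alexander module\<close>

definition crossing_relation :: "vdiagram \<Rightarrow> complex \<Rightarrow> complex set \<Rightarrow> laurent" where
  "crossing_relation D c =
     (\<lambda>x. (1 - tvar) * of_bool (x = over_arc D c)
          + tvar * of_bool (x = right_arc D c) - of_bool (x = left_arc D c))"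

definition rho :: "vdiagram \<Rightarrow> (complex \<Rightarrow> laurent) \<Rightarrow> (complex set \<Rightarrow> laurent)" where
  "rho D f = (\<lambda>x. \<Sum>c \<in> crossings D. f c * crossing_relation D c x)"

definition relation_module :: "vdiagram \<Rightarrow> (complex set \<Rightarrow> laurent) set" where
  "relation_module D = rho D ` carrier (free_module (crossings D))"

definition M_red :: "vdiagram \<Rightarrow> (laurent, (complex set \<Rightarrow> laurent) set) module" where
  "M_red D = quotient_module (free_module (arcs D)) (relation_module D)"

definition sigma :: "vdiagram \<Rightarrow> (complex set \<Rightarrow> laurent) \<Rightarrow> (complex set \<Rightarrow> laurent) set" where
  "sigma D f = relation_module D +>\<^bsub>free_module (arcs D)\<^esub> f"

text \<open>
  \<open>phi D\<close> is induced by the linear map on the free module sending each arc to \<open>1\<close>, which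
  is constant on the cosets because \<open>(1 - t) + t - 1 = 0\<close>.
\<close>

definition phi :: "vdiagram \<Rightarrow> (complex set \<Rightarrow> laurent) set \<Rightarrow> laurent" where
  "phi D A = the_elem ((\<lambda>f. \<Sum>x \<in> arcs D. f x) ` A)"

definition ker_phi :: "vdiagram \<Rightarrow> (laurent, (complex set \<Rightarrow> laurent) set) module" where
  "ker_phi D = (M_red D) \<lparr>carrier := {A \<in> carrier (M_red D). phi D A = 0}\<rparr>"

definition meridians :: "vdiagram \<Rightarrow> (complex set \<Rightarrow> laurent) set set" where
  "meridians D = {A \<in> carrier (M_red D). phi D A = 1}"

text \<open>The sum halved here is even at every arc, so \<open>div\<close> is exact.\<close>

definition longitude :: "vdiagram \<Rightarrow> (complex set \<Rightarrow> laurent) set" where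
  "longitude D = sigma D (\<lambda>x. of_int (
     (\<Sum>c \<in> crossings D. writhe D c * of_bool (x = over_arc D c))
     - (\<Sum>c \<in> crossings D.
          writhe D c * (of_bool (x = right_arc D c) + of_bool (x = left_arc D c))) div 2))"

type_synonym 'm enhanced_module = "(laurent, 'm) module \<times> 'm set \<times> 'm"

definition M_enr :: "vdiagram \<Rightarrow> (complex set \<Rightarrow> laurent) set enhanced_module" where
  "M_enr D = (M_red D, meridians D, longitude D)"

definition isomorphic_enhanced :: "'m enhanced_module \<Rightarrow> 'n enhanced_module \<Rightarrow> bool" where
  "isomorphic_enhanced E E' \<longleftrightarrow>
     (case E of (M, M\<^sub>1, l) \<Rightarrow> case E' of (M', M\<^sub>1', l') \<Rightarrow>
        \<exists>f \<in> module_isos Laurent M M'. f ` M\<^sub>1 = M\<^sub>1' \<and> f l = l')"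

end

theory Submission
  imports Defs "HOL-Library.Function_Algebras" "HOL-Library.Real_Mod"
begin

text \<open>
  The longitude of a one-component diagram vanishes.  Running once around the knot, the terms
  \<open>w(c) (b\<^sub>2(c) - b\<^sub>1(c))\<close> telescope to \<open>0\<close> in the free module.  Hence \<open>\<chi>\<^sub>1\<close> is the class of
  \<open>\<Sum> w(c) (a(c) - b\<^sub>1(c))\<close>, and the crossing relations \<open>b\<^sub>2 - b\<^sub>1 = (1 - t) (a - b\<^sub>1)\<close> give
  \<open>(1 - t) \<chi>\<^sub>1 = 0\<close>.  The same relations together with connectedness of the knot show that
  \<open>1 - t\<close> maps the finitely generated module \<open>ker \<phi>\<close> onto itself, so by Nakayama's lemma an element
  congruent to \<open>1\<close> modulo \<open>1 - t\<close> annihilates \<open>ker \<phi>\<close>; thus \<open>1 - t\<close> is injective there and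
  \<open>\<chi>\<^sub>1 = 0\<close>.

  Without the longitude the statement is about augmented modules.  Any meridian \<open>m\<close> splits
  \<open>M = ker \<phi> \<oplus> \<Lambda> m\<close>, so an isomorphism of kernels extends by \<open>m \<mapsto> m'\<close>; conversely an isomorphism
  which preserves the level set \<open>\<phi> = 1\<close> preserves \<open>\<phi>\<close>.
\<close>

section \<open>Nakayama's lemma\<close>

lemma (in Modules.module) nakayama_annihilator:
  assumes "finite S" and "subspace W"
    and "\<And>d. d \<in> S \<Longrightarrow> \<exists>u \<in> span S. d - scale p u \<in> W"
  shows "\<exists>r. \<forall>d \<in> S. scale (1 + p * r) d \<in> W"
  using assms
proof (induction S arbitrary: W rule: finite_induct)
  case empty
  then show ?case by simp
next
  case (insert d S)
  note W = insert.prems(1)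
  define W' where "W' = {x. \<exists>k. x - scale k d \<in> W}"
  have W'_eq: "W' = span (insert d W)"
    using W by (auto simp: W'_def span_insert span_eq_iff[THEN iffD2])
  then have W': "subspace W'" by simp
  have in_W': "w \<in> W \<Longrightarrow> w \<in> W'" for w
    by (simp add: W'_eq span_base)
  have d_W': "scale k d \<in> W'" for k
    by (simp add: W'_eq span_base span_scale)
  have reduce: "\<exists>u' \<in> span S. x - scale p u' \<in> W'" if x: "x \<in> insert d S" for x
  proof -
    obtain u where u: "u \<in> span (insert d S)" "x - scale p u \<in> W"
      using insert.prems(2)[OF x] by blast
    then obtain k where k: "u - scale k d \<in> span S"
      by (auto simp: span_insert)
    have "x - scale p (u - scale k d) = (x - scale p u) + scale (p * k) d"
      by (simp add: scale_right_diff_distrib)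
    then have "x - scale p (u - scale k d) \<in> W'"
      using subspace_add[OF W' in_W'[OF u(2)] d_W'] by metis
    with k show ?thesis by blast
  qed
  then obtain r where r: "\<And>x. x \<in> S \<Longrightarrow> scale (1 + p * r) x \<in> W'"
    using insert.IH[OF W'] by blast
  let ?s = "1 + p * r"
  have span_W': "scale ?s x \<in> W'" if "x \<in> span (insert d S)" for x
    using that
  proof (induction rule: span_induct_alt)
    case base
    then show ?case by (simp add: subspace_0[OF W'])
  next
    case (step c x y)
    have "scale ?s x \<in> W'"
      using step.hyps r d_W' by blast
    then have "scale c (scale ?s x) + scale ?s y \<in> W'"
      using step.IH W' subspace_add subspace_scale by blast
    then show ?case
      by (simp add: scale_right_distrib mult.commute)
  qed
  obtain u where u: "u \<in> span (insert d S)" "d - scale p u \<in> W"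
    using insert.prems(2)[OF insertI1] by blast
  obtain k where k: "scale ?s u - scale k d \<in> W"
    using span_W'[OF u(1)] by (auto simp: W'_def)
  have "scale (?s - p * k) d =
      scale ?s (d - scale p u) + scale p (scale ?s u - scale k d)"
    by (simp add: scale_left_diff_distrib scale_right_diff_distrib mult.commute)
  then have d: "scale (?s - p * k) d \<in> W"
    using subspace_add[OF W subspace_scale[OF W u(2)] subspace_scale[OF W k]] by metis
  have all: "scale ((?s - p * k) * ?s) x \<in> W" if x: "x \<in> insert d S" for x
  proof -
    obtain l where l: "scale ?s x - scale l d \<in> W"
      using span_W'[OF span_base[OF x]] by (auto simp: W'_def)
    have "scale ((?s - p * k) * ?s) x =
        scale (?s - p * k) (scale ?s x - scale l d) + scale l (scale (?s - p * k) d)"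
      by (simp add: scale_right_diff_distrib mult.commute)
    then show ?thesis
      using subspace_add[OF W subspace_scale[OF W l] subspace_scale[OF W d]] by metis
  qed
  have "(?s - p * k) * ?s = 1 + p * (r + r + p * r * r - k - k * p * r)"
    by (simp add: algebra_simps)
  then show ?case
    using all by metis
qed

lemma (in Modules.module) nakayama_torsion_free:
  assumes "finite S" and W: "subspace W"
    and "\<And>d. d \<in> S \<Longrightarrow> \<exists>u \<in> span S. d - scale p u \<in> W"
    and "v \<in> span S" and pv: "scale p v \<in> W"
  shows "v \<in> W"
proof -
  obtain r where r: "\<And>d. d \<in> S \<Longrightarrow> scale (1 + p * r) d \<in> W"
    using nakayama_annihilator[OF assms(1-3)] by blast
  have "scale (1 + p * r) v \<in> W"
    using \<open>v \<in> span S\<close>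
  proof (induction rule: span_induct_alt)
    case base
    then show ?case by (simp add: subspace_0[OF W])
  next
    case (step c x y)
    have "scale c (scale (1 + p * r) x) + scale (1 + p * r) y \<in> W"
      using step r W subspace_add subspace_scale by blast
    then show ?case
      by (simp add: scale_right_distrib mult.commute)
  qed
  moreover have "v = scale (1 + p * r) v - scale r (scale p v)"
    by (simp add: scale_left_distrib mult.commute)
  ultimately show ?thesis
    using subspace_diff[OF W _ subspace_scale[OF W pv]] by metis
qed

section \<open>Augmented modules\<close>

lemma ring_of_type_algebra_simps [simp]:
  fixes a b :: "'r::comm_ring_1"
  shows "a \<in> carrier ring_of_type_algebra"
    and "a \<oplus>\<^bsub>ring_of_type_algebra\<^esub> b = a + b"
    and "a \<otimes>\<^bsub>ring_of_type_algebra\<^esub> b = a * b"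
    and "\<zero>\<^bsub>(ring_of_type_algebra :: 'r ring)\<^esub> = 0"
    and "\<one>\<^bsub>(ring_of_type_algebra :: 'r ring)\<^esub> = 1"
  by (simp_all add: ring_of_type_algebra_def)

locale augmented_module = Module.module "ring_of_type_algebra :: 'r ring" M
  for M :: "('r::comm_ring_1, 'm) module" (structure) +
  fixes \<phi> :: "'m \<Rightarrow> 'r" and m :: 'm
  assumes aug_add: "\<lbrakk>x \<in> carrier M; y \<in> carrier M\<rbrakk> \<Longrightarrow> \<phi> (x \<oplus>\<^bsub>M\<^esub> y) = \<phi> x + \<phi> y"
    and aug_smult: "x \<in> carrier M \<Longrightarrow> \<phi> (r \<odot>\<^bsub>M\<^esub> x) = r * \<phi> x"
    and m_closed: "m \<in> carrier M"
    and aug_m: "\<phi> m = 1"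
begin

declare m_closed [simp]

definition ker_part :: "'m \<Rightarrow> 'm" where
  "ker_part x = x \<oplus>\<^bsub>M\<^esub> (- \<phi> x) \<odot>\<^bsub>M\<^esub> m"

lemma smult_add_smult [simp]:
  "x \<in> carrier M \<Longrightarrow> a \<odot>\<^bsub>M\<^esub> x \<oplus>\<^bsub>M\<^esub> b \<odot>\<^bsub>M\<^esub> x = (a + b) \<odot>\<^bsub>M\<^esub> x"
  using smult_l_distr[of a b x] by simp

lemma smult_zero_left [simp]: "x \<in> carrier M \<Longrightarrow> 0 \<odot>\<^bsub>M\<^esub> x = \<zero>\<^bsub>M\<^esub>"
  using smult_l_null by simp

lemma ker_part_closed [simp]: "x \<in> carrier M \<Longrightarrow> ker_part x \<in> carrier M"
  by (simp add: ker_part_def)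

lemma aug_ker_part [simp]: "x \<in> carrier M \<Longrightarrow> \<phi> (ker_part x) = 0"
  by (simp add: ker_part_def aug_add aug_smult aug_m)

lemma ker_part_decomp: "x \<in> carrier M \<Longrightarrow> ker_part x \<oplus>\<^bsub>M\<^esub> \<phi> x \<odot>\<^bsub>M\<^esub> m = x"
  by (simp add: ker_part_def M.a_assoc)

lemma ker_part_add:
  assumes "x \<in> carrier M" "y \<in> carrier M"
  shows "ker_part (x \<oplus>\<^bsub>M\<^esub> y) = ker_part x \<oplus>\<^bsub>M\<^esub> ker_part y"
proof -
  have "(- \<phi> x - \<phi> y) \<odot>\<^bsub>M\<^esub> m = (- \<phi> x) \<odot>\<^bsub>M\<^esub> m \<oplus>\<^bsub>M\<^esub> (- \<phi> y) \<odot>\<^bsub>M\<^esub> m"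
    by simp
  then show ?thesis
    using assms by (simp add: ker_part_def aug_add M.a_ac del: smult_add_smult)
qed

lemma ker_part_smult:
  assumes "x \<in> carrier M"
  shows "ker_part (r \<odot>\<^bsub>M\<^esub> x) = r \<odot>\<^bsub>M\<^esub> ker_part x"
  using assms smult_r_distr[of r x "(- \<phi> x) \<odot>\<^bsub>M\<^esub> m"] smult_assoc1[of r "- \<phi> x" m]
  by (simp add: ker_part_def aug_smult)

lemma ker_part_kernel: "\<lbrakk>k \<in> carrier M; \<phi> k = 0\<rbrakk> \<Longrightarrow> ker_part (k \<oplus>\<^bsub>M\<^esub> r \<odot>\<^bsub>M\<^esub> m) = k"
  by (simp add: ker_part_def aug_add aug_smult aug_m M.a_assoc)

end

abbreviation aug_kernel :: "('r, 'm) module \<Rightarrow> ('m \<Rightarrow> 'r::zero) \<Rightarrow> ('r, 'm) module" where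
  "aug_kernel M \<phi> \<equiv> M\<lparr>carrier := {x \<in> carrier M. \<phi> x = 0}\<rparr>"

lemma module_homs_zero:
  assumes "Module.module R M" "Module.module R N" "f \<in> module_homs R M N"
  shows "f \<zero>\<^bsub>M\<^esub> = \<zero>\<^bsub>N\<^esub>"
proof -
  interpret M: Module.module R M by fact
  interpret N: Module.module R N by fact
  have "f (\<zero>\<^bsub>R\<^esub> \<odot>\<^bsub>M\<^esub> \<zero>\<^bsub>M\<^esub>) = \<zero>\<^bsub>R\<^esub> \<odot>\<^bsub>N\<^esub> f \<zero>\<^bsub>M\<^esub>" "f \<zero>\<^bsub>M\<^esub> \<in> carrier N"
    using assms(3) M.M.zero_closed M.R.zero_closed unfolding module_homs_def by blast+
  then show ?thesis by simp
qed

lemma isomorphic_aug_kernel_if_unit_level_iso: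
  assumes "augmented_module M \<phi> m" "augmented_module N \<psi> n"
    and f: "f \<in> module_isos (ring_of_type_algebra :: 'r::comm_ring_1 ring) M N"
    and level: "f ` {x \<in> carrier M. \<phi> x = 1} = {y \<in> carrier N. \<psi> y = 1}"
  shows "isomorphic_modules (ring_of_type_algebra :: 'r ring) (aug_kernel M \<phi>) (aug_kernel N \<psi>)"
proof -
  interpret M: augmented_module M \<phi> m by fact
  interpret N: augmented_module N \<psi> n by fact
  have fc: "f x \<in> carrier N" if "x \<in> carrier M" for x
    using f that by (auto simp: module_isos_def module_homs_def)
  have fadd: "f (x \<oplus>\<^bsub>M\<^esub> y) = f x \<oplus>\<^bsub>N\<^esub> f y" if "x \<in> carrier M" "y \<in> carrier M" for x y
    using f that by (auto simp: module_isos_def module_homs_def)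
  have fsmult: "f (r \<odot>\<^bsub>M\<^esub> x) = r \<odot>\<^bsub>N\<^esub> f x" if "x \<in> carrier M" for r x
    using f that by (auto simp: module_isos_def module_homs_def)
  have bij: "bij_betw f (carrier M) (carrier N)"
    using f by (simp add: module_isos_def)
  have level': "\<psi> (f x) = 1" if "x \<in> carrier M" "\<phi> x = 1" for x
    using level that by blast
  have aug: "\<psi> (f x) = \<phi> x" if x: "x \<in> carrier M" for x
  proof -
    have "\<psi> (f (M.ker_part x \<oplus>\<^bsub>M\<^esub> m)) = 1"
      using x by (intro level') (simp_all add: M.aug_add M.aug_m)
    then have "\<psi> (f (M.ker_part x)) = 0"
      using x level'[OF M.m_closed M.aug_m] by (simp add: fadd fc N.aug_add)
    moreover have "f x = f (M.ker_part x) \<oplus>\<^bsub>N\<^esub> \<phi> x \<odot>\<^bsub>N\<^esub> f m"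
      using fadd[of "M.ker_part x" "\<phi> x \<odot>\<^bsub>M\<^esub> m"] x
      by (simp add: M.ker_part_decomp fsmult)
    ultimately show ?thesis
      using x level'[OF M.m_closed M.aug_m] by (simp add: fc N.aug_add N.aug_smult)
  qed
  have "bij_betw f {x \<in> carrier M. \<phi> x = 0} {y \<in> carrier N. \<psi> y = 0}"
  proof (rule bij_betw_subset[OF bij])
    show "f ` {x \<in> carrier M. \<phi> x = 0} = {y \<in> carrier N. \<psi> y = 0}"
    proof
      show "{y \<in> carrier N. \<psi> y = 0} \<subseteq> f ` {x \<in> carrier M. \<phi> x = 0}"
      proof
        fix y assume y: "y \<in> {y \<in> carrier N. \<psi> y = 0}"
        then have "y \<in> f ` carrier M"
          using bij by (simp add: bij_betw_def)
        then obtain x where "x \<in> carrier M" "f x = y" by auto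
        with y aug show "y \<in> f ` {x \<in> carrier M. \<phi> x = 0}" by auto
      qed
    qed (use fc aug in auto)
  qed auto
  then have "f \<in> module_isos ring_of_type_algebra (aug_kernel M \<phi>) (aug_kernel N \<psi>)"
    using fc fadd fsmult aug by (auto simp: module_isos_def module_homs_def)
  then show ?thesis
    by (auto simp: isomorphic_modules_def)
qed

lemma unit_level_iso_if_isomorphic_aug_kernel:
  assumes "augmented_module M \<phi> m" "augmented_module N \<psi> n"
    and "isomorphic_modules (ring_of_type_algebra :: 'r::comm_ring_1 ring)
           (aug_kernel M \<phi>) (aug_kernel N \<psi>)"
  shows "\<exists>f \<in> module_isos (ring_of_type_algebra :: 'r ring) M N.
           f ` {x \<in> carrier M. \<phi> x = 1} = {y \<in> carrier N. \<psi> y = 1}"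
proof -
  interpret M: augmented_module M \<phi> m by fact
  interpret N: augmented_module N \<psi> n by fact
  obtain g where g: "g \<in> module_isos ring_of_type_algebra (aug_kernel M \<phi>) (aug_kernel N \<psi>)"
    using assms(3) by (auto simp: isomorphic_modules_def)
  have gc: "g x \<in> carrier N" "\<psi> (g x) = 0" if "x \<in> carrier M" "\<phi> x = 0" for x
    using g that by (auto simp: module_isos_def module_homs_def)
  have gadd: "g (x \<oplus>\<^bsub>M\<^esub> y) = g x \<oplus>\<^bsub>N\<^esub> g y"
    if "x \<in> carrier M" "\<phi> x = 0" "y \<in> carrier M" "\<phi> y = 0" for x y
    using g that by (auto simp: module_isos_def module_homs_def)
  have gsmult: "g (r \<odot>\<^bsub>M\<^esub> x) = r \<odot>\<^bsub>N\<^esub> g x" if "x \<in> carrier M" "\<phi> x = 0" for r x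
    using g that by (auto simp: module_isos_def module_homs_def)
  have bij: "bij_betw g {x \<in> carrier M. \<phi> x = 0} {y \<in> carrier N. \<psi> y = 0}"
    using g by (simp add: module_isos_def)
  define f where "f x = g (M.ker_part x) \<oplus>\<^bsub>N\<^esub> \<phi> x \<odot>\<^bsub>N\<^esub> n" for x
  have fc: "f x \<in> carrier N" if "x \<in> carrier M" for x
    using that by (simp add: f_def gc)
  have aug: "\<psi> (f x) = \<phi> x" if "x \<in> carrier M" for x
    using that by (simp add: f_def gc N.aug_add N.aug_smult N.aug_m)
  have fker: "N.ker_part (f x) = g (M.ker_part x)" if "x \<in> carrier M" for x
    using that by (simp add: f_def gc N.ker_part_kernel)
  have fadd: "f (x \<oplus>\<^bsub>M\<^esub> y) = f x \<oplus>\<^bsub>N\<^esub> f y" if "x \<in> carrier M" "y \<in> carrier M" for x y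
  proof -
    have "(\<phi> x + \<phi> y) \<odot>\<^bsub>N\<^esub> n = \<phi> x \<odot>\<^bsub>N\<^esub> n \<oplus>\<^bsub>N\<^esub> \<phi> y \<odot>\<^bsub>N\<^esub> n"
      by simp
    then show ?thesis
      using that
      by (simp add: f_def M.ker_part_add M.aug_add gadd gc N.M.a_ac del: N.smult_add_smult)
  qed
  have fsmult: "f (r \<odot>\<^bsub>M\<^esub> x) = r \<odot>\<^bsub>N\<^esub> f x" if "x \<in> carrier M" for r x
    using that N.smult_r_distr[of r "g (M.ker_part x)" "\<phi> x \<odot>\<^bsub>N\<^esub> n"]
      N.smult_assoc1[of r "\<phi> x" n]
    by (simp add: f_def M.ker_part_smult M.aug_smult gsmult gc)
  have "inj_on f (carrier M)"
  proof (rule inj_onI)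
    fix x y assume xy: "x \<in> carrier M" "y \<in> carrier M" "f x = f y"
    then have "g (M.ker_part x) = g (M.ker_part y)"
      using fker by metis
    then have "M.ker_part x = M.ker_part y"
      using bij xy by (auto simp: bij_betw_def inj_on_def)
    moreover have "\<phi> x = \<phi> y"
      using aug xy by metis
    ultimately show "x = y"
      using xy M.ker_part_decomp by metis
  qed
  moreover have surj: "\<exists>x \<in> carrier M. f x = y" if y: "y \<in> carrier N" for y
  proof -
    have "N.ker_part y \<in> g ` {x \<in> carrier M. \<phi> x = 0}"
      using bij y by (simp add: bij_betw_def)
    then obtain k where k: "k \<in> carrier M" "\<phi> k = 0" "g k = N.ker_part y"
      by auto
    have "f (k \<oplus>\<^bsub>M\<^esub> \<psi> y \<odot>\<^bsub>M\<^esub> m) = y"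
      using k N.ker_part_decomp[OF y]
      by (simp add: f_def M.ker_part_kernel M.aug_add M.aug_smult M.aug_m)
    moreover have "k \<oplus>\<^bsub>M\<^esub> \<psi> y \<odot>\<^bsub>M\<^esub> m \<in> carrier M"
      using k by simp
    ultimately show ?thesis by blast
  qed
  ultimately have "bij_betw f (carrier M) (carrier N)"
    unfolding bij_betw_def using fc by blast
  then have "f \<in> module_isos ring_of_type_algebra M N"
    using fc fadd fsmult by (auto simp: module_isos_def module_homs_def)
  moreover have "f ` {x \<in> carrier M. \<phi> x = 1} = {y \<in> carrier N. \<psi> y = 1}"
  proof
    show "{y \<in> carrier N. \<psi> y = 1} \<subseteq> f ` {x \<in> carrier M. \<phi> x = 1}"
    proof
      fix y assume y: "y \<in> {y \<in> carrier N. \<psi> y = 1}"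
      then obtain x where "x \<in> carrier M" "f x = y"
        using surj by blast
      with y aug show "y \<in> f ` {x \<in> carrier M. \<phi> x = 1}" by auto
    qed
  qed (use fc aug in auto)
  ultimately show ?thesis by blast
qed


section \<open>Finitely many points on the circle\<close>

lemma cis_eq_imp_eq:
  assumes "cis s = cis t" and "\<bar>s - t\<bar> < 2 * pi"
  shows "s = t"
proof -
  have "cis (s - t) = 1"
    using assms(1) by (simp flip: cis_divide)
  then obtain n :: int where n: "s - t = of_int n * (2 * pi)"
    by (auto simp: cis_eq_1_iff)
  with assms(2) have "\<bar>real_of_int n\<bar> < 1"
    by (simp add: abs_mult)
  then have "n = 0" by linarith
  with n show ?thesis by simp
qed

lemma obtain_angle:
  assumes "u \<in> S1" "z \<in> S1"
  obtains s where "0 \<le> s" "s < 2 * pi" "z = u * cis s"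
proof -
  have u: "u \<noteq> 0" using assms by auto
  have "norm (z / u) = 1"
    using assms by (simp add: norm_divide)
  then obtain s where "0 \<le> s" "s < 2 * pi" "z / u = cis s"
    by (metis complex_unit_circle complex_eq_iff cis.sel sincos_total_2pi cmod_power2 power_one)
  with u show ?thesis
    by (intro that[of s]) (auto simp: field_simps)
qed

lemma components_circle: "components S1 = {S1}"
proof -
  have "connected S1"
    by (rule connected_sphere) simp
  then show ?thesis
    by (subst components_eq_sing_iff) auto
qed

locale circle_points =
  fixes U :: "complex set"
  assumes finite_points: "finite U" and points_on_circle: "U \<subseteq> S1"
begin

definition gap :: "complex \<Rightarrow> real" where
  "gap u = Min {s \<in> {0<..2 * pi}. u * cis s \<in> U}"

definition next_point :: "complex \<Rightarrow> complex" where
  "next_point u = u * cis (gap u)"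

definition next_arc :: "complex \<Rightarrow> complex set" where
  "next_arc u = (\<lambda>s. u * cis s) ` {0<..<gap u}"

lemma point_norm [simp]: "u \<in> U \<Longrightarrow> norm u = 1"
  using points_on_circle by auto

lemma point_nonzero: "u \<in> U \<Longrightarrow> u \<noteq> 0"
  using point_norm by fastforce

lemma
  assumes u: "u \<in> U"
  shows gap_pos: "0 < gap u"
    and next_point_in: "next_point u \<in> U"
    and gap_minimal: "\<And>s. \<lbrakk>0 < s; u * cis s \<in> U\<rbrakk> \<Longrightarrow> gap u \<le> s"
proof -
  let ?A = "{s \<in> {0<..2 * pi}. u * cis s \<in> U}"
  have "inj_on (\<lambda>s. u * cis s) {0<..2 * pi}"
    using point_nonzero[OF u] by (auto intro!: inj_onI cis_eq_imp_eq)
  then have "finite ((\<lambda>s. u * cis s) -` U \<inter> {0<..2 * pi})"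
    by (rule finite_vimage_IntI[OF finite_points])
  then have fin: "finite ?A"
    by (rule rev_finite_subset) auto
  moreover have two_pi: "2 * pi \<in> ?A"
    using u by simp
  ultimately have "gap u \<in> ?A"
    unfolding gap_def using Min_in by blast
  then show "0 < gap u" and "next_point u \<in> U"
    by (auto simp: next_point_def)
  have le: "gap u \<le> 2 * pi" using \<open>gap u \<in> ?A\<close> by simp
  show "gap u \<le> s" if "0 < s" "u * cis s \<in> U" for s
  proof (cases "s \<le> 2 * pi")
    case True
    with that show ?thesis
      unfolding gap_def by (intro Min_le[OF fin]) auto
  next
    case False
    with le show ?thesis by simp
  qed
qed

lemma obtain_last_point_before:
  assumes "V \<subseteq> U" "V \<noteq> {}" "z \<in> S1"
  obtains u s where "u \<in> V" "0 \<le> s" "s < 2 * pi" "z = u * cis s"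
    "\<And>s'. \<lbrakk>0 \<le> s'; s' < s\<rbrakk> \<Longrightarrow> z * cis (- s') \<notin> V"
proof -
  let ?A = "{s \<in> {0..<2 * pi}. z * cis (- s) \<in> V}"
  have "inj_on (\<lambda>s. z * cis (- s)) {0..<2 * pi}"
  proof (rule inj_onI)
    fix s t
    assume "s \<in> {0..<2 * pi}" "t \<in> {0..<2 * pi}" "z * cis (- s) = z * cis (- t)"
    moreover have "z \<noteq> 0" using \<open>z \<in> S1\<close> by auto
    ultimately have "- s = - t"
      by (intro cis_eq_imp_eq) auto
    then show "s = t" by simp
  qed
  then have "finite ((\<lambda>s. z * cis (- s)) -` V \<inter> {0..<2 * pi})"
    using finite_subset[OF assms(1) finite_points] by (rule finite_vimage_IntI[rotated])
  then have fin: "finite ?A"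
    by (rule rev_finite_subset) auto
  have cancel: "w * cis s * cis (- s) = w" "w * cis (- s) * cis s = w" for w s
    by (simp_all add: mult.assoc cis_mult)
  obtain x where x: "x \<in> V" using assms(2) by blast
  then have "x \<in> S1"
    using assms(1) points_on_circle by blast
  then obtain r where "0 \<le> r" "r < 2 * pi" "z = x * cis r"
    using \<open>z \<in> S1\<close> by (rule obtain_angle)
  then have "r \<in> ?A"
    using x by (simp add: cancel)
  then have min: "Min ?A \<in> ?A"
    using Min_in[OF fin] by blast
  show thesis
  proof (rule that)
    show "z = (z * cis (- Min ?A)) * cis (Min ?A)"
      by (simp add: cancel)
    show "z * cis (- s') \<notin> V" if s': "0 \<le> s'" "s' < Min ?A" for s'
    proof
      assume "z * cis (- s') \<in> V"
      then have "s' \<in> ?A" using s' min by auto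
      then show False using Min_le[OF fin] s' by fastforce
    qed
  qed (use min in auto)
qed

lemma next_point_earlier:
  assumes "z = u * cis s"
  shows "z * cis (- (s - gap u)) = next_point u"
  unfolding assms next_point_def by (simp add: mult.assoc cis_mult)

lemma next_point_transitive:
  assumes "V \<subseteq> U" "V \<noteq> {}" and closed: "\<And>u. u \<in> V \<Longrightarrow> next_point u \<in> V"
  shows "V = U"
proof
  show "U \<subseteq> V"
  proof
    fix v assume v: "v \<in> U"
    then have "v \<in> S1" using points_on_circle by blast
    then obtain u s where us: "u \<in> V" "0 \<le> s" "s < 2 * pi" "v = u * cis s"
      and first: "\<And>s'. \<lbrakk>0 \<le> s'; s' < s\<rbrakk> \<Longrightarrow> v * cis (- s') \<notin> V"
      using obtain_last_point_before[OF assms(1,2)] by metis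
    have u: "u \<in> U" using us assms(1) by blast
    show "v \<in> V"
    proof (cases "s = 0")
      case True
      with us show ?thesis by simp
    next
      case False
      then have "gap u \<le> s"
        using gap_minimal[OF u] us v by simp
      then have "v * cis (- (s - gap u)) \<notin> V"
        using gap_pos[OF u] by (intro first) auto
      then show ?thesis
        using next_point_earlier[OF us(4)] closed[OF us(1)] by simp
    qed
  qed
qed fact

lemma inj_next_point: "inj_on next_point U"
proof (rule inj_onI)
  have *: "u = v" if uv: "u \<in> U" "v \<in> U" "next_point u = next_point v" "gap u \<le> gap v" for u v
  proof -
    have "v * cis (gap v - gap u) = next_point v * cis (- gap u)"
      by (simp add: next_point_def mult.assoc cis_mult)
    also have "\<dots> = u"
      unfolding uv(3)[symmetric] by (simp add: next_point_def mult.assoc cis_mult)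
    finally have u: "v * cis (gap v - gap u) = u" .
    then have "\<not> 0 < gap v - gap u"
      using gap_minimal[OF uv(2), of "gap v - gap u"] gap_pos[OF uv(1)] uv(1) by auto
    with uv(4) have "gap v = gap u" by simp
    with u show ?thesis by simp
  qed
  fix u v assume "u \<in> U" "v \<in> U" "next_point u = next_point v"
  then show "u = v"
    using *[of u v] *[of v u] by (cases "gap u \<le> gap v") auto
qed

lemma bij_next_point: "bij_betw next_point U U"
  using endo_inj_surj[OF finite_points _ inj_next_point] next_point_in inj_next_point
  by (simp add: bij_betw_def image_subset_iff)

lemma next_arc_component:
  assumes u: "u \<in> U"
  shows "next_arc u \<in> components (S1 - U)"
  unfolding in_components_maximal
proof (intro conjI allI impI)
  let ?f = "\<lambda>s. u * cis s"
  have cont: "continuous_on T ?f" for T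
    by (intro continuous_intros)
  show "next_arc u \<noteq> {}"
    using gap_pos[OF u] by (simp add: next_arc_def)
  show sub: "next_arc u \<subseteq> S1 - U"
  proof
    fix z assume "z \<in> next_arc u"
    then obtain s where s: "0 < s" "s < gap u" "z = ?f s"
      by (auto simp: next_arc_def)
    then show "z \<in> S1 - U"
      using gap_minimal[OF u, of s] u by (auto simp: norm_mult)
  qed
  show "connected (next_arc u)"
    unfolding next_arc_def by (intro connected_continuous_image cont connected_Ioo)
  fix d assume d: "d \<noteq> {} \<and> next_arc u \<subseteq> d \<and> d \<subseteq> S1 - U \<and> connected d"
  let ?A = "?f ` {0..gap u}" and ?B = "?f ` {gap u..2 * pi}"
  have "closed ?A" "closed ?B"
    by (intro compact_imp_closed compact_continuous_image cont compact_Icc)+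
  moreover have "d \<subseteq> ?A \<union> ?B"
  proof
    fix z assume "z \<in> d"
    then have "z \<in> S1" "u \<in> S1" using d u points_on_circle by auto
    then obtain s where "0 \<le> s" "s < 2 * pi" "z = ?f s"
      using obtain_angle by metis
    then show "z \<in> ?A \<union> ?B" by (cases "s \<le> gap u") auto
  qed
  moreover have "?A \<inter> ?B \<inter> d = {}"
  proof -
    have "?f s \<in> U" if "?f s = ?f t" "s \<in> {0..gap u}" "t \<in> {gap u..2 * pi}" for s t
    proof (cases "\<bar>s - t\<bar> < 2 * pi")
      case True
      then have "s = t"
        using that(1) point_nonzero[OF u] by (intro cis_eq_imp_eq) auto
      then have "s = gap u" using that by auto
      then show ?thesis
        using next_point_in[OF u] by (simp add: next_point_def)
    next
      case False
      then have "s = 0" using that by auto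
      then show ?thesis using u by simp
    qed
    then show ?thesis using d by blast
  qed
  ultimately have "?A \<inter> d = {} \<or> ?B \<inter> d = {}"
    using d by (intro connected_closedD) auto
  moreover have "next_arc u \<subseteq> ?A"
    by (auto simp: next_arc_def)
  then have "?A \<inter> d \<noteq> {}"
    using \<open>next_arc u \<noteq> {}\<close> d by blast
  ultimately have "?B \<inter> d = {}" by blast
  with \<open>d \<subseteq> ?A \<union> ?B\<close> have dA: "d \<subseteq> ?A" by blast
  have "d \<subseteq> next_arc u"
  proof
    fix z assume z: "z \<in> d"
    then have "z \<in> ?A" using dA by blast
    then obtain s where s: "0 \<le> s" "s \<le> gap u" "z = ?f s" by auto
    moreover have "z \<notin> U" using z d by auto
    ultimately have "s \<noteq> 0" "s \<noteq> gap u"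
      using u next_point_in[OF u] by (auto simp: next_point_def)
    with s show "z \<in> next_arc u" by (auto simp: next_arc_def)
  qed
  with d show "d = next_arc u" by blast
qed

lemma components_eq_next_arcs:
  assumes "U \<noteq> {}"
  shows "components (S1 - U) = next_arc ` U"
proof
  show "next_arc ` U \<subseteq> components (S1 - U)"
    using next_arc_component by blast
  show "components (S1 - U) \<subseteq> next_arc ` U"
  proof
    fix x assume x: "x \<in> components (S1 - U)"
    then obtain z where z: "z \<in> x" using in_components_nonempty by blast
    then have zU: "z \<in> S1" "z \<notin> U" using x in_components_subset by blast+
    obtain u s where us: "u \<in> U" "0 \<le> s" "s < 2 * pi" "z = u * cis s"
      and first: "\<And>s'. \<lbrakk>0 \<le> s'; s' < s\<rbrakk> \<Longrightarrow> z * cis (- s') \<notin> U"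
      using obtain_last_point_before[OF order_refl assms zU(1)] by metis
    have "s \<noteq> 0" using us zU by auto
    moreover have "s < gap u"
    proof (rule ccontr)
      assume "\<not> s < gap u"
      then have "z * cis (- (s - gap u)) \<notin> U"
        using gap_pos[OF us(1)] by (intro first) auto
      then show False
        using next_point_earlier[OF us(4)] next_point_in[OF us(1)] by simp
    qed
    ultimately have "z \<in> next_arc u"
      using us by (auto simp: next_arc_def)
    then have "x = next_arc u"
      using components_nonoverlap[OF x next_arc_component[OF us(1)]] z by blast
    with us show "x \<in> next_arc ` U" by blast
  qed
qed

lemma finite_components: "finite (components (S1 - U))"
  and components_nonempty: "components (S1 - U) \<noteq> {}"
  using components_circle components_eq_next_arcs finite_points by (cases "U = {}"; simp)+

lemma arc_after_point:
  assumes u: "u \<in> U"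
  shows "(THE x. x \<in> components (S1 - U) \<and> (\<forall>\<^sub>F s in at_right 0. u * cis s \<in> x)) = next_arc u"
proof (rule the_equality)
  have ev: "\<forall>\<^sub>F s in at_right 0. u * cis s \<in> next_arc u"
    using gap_pos[OF u] unfolding eventually_at_right_field
    by (intro exI[of _ "gap u"]) (auto simp: next_arc_def)
  then show "next_arc u \<in> components (S1 - U) \<and> (\<forall>\<^sub>F s in at_right 0. u * cis s \<in> next_arc u)"
    using next_arc_component[OF u] by blast
  fix x assume x: "x \<in> components (S1 - U) \<and> (\<forall>\<^sub>F s in at_right 0. u * cis s \<in> x)"
  then have "\<forall>\<^sub>F s in at_right 0. u * cis s \<in> x \<inter> next_arc u"
    using ev by (auto elim: eventually_elim2)
  then have "x \<inter> next_arc u \<noteq> {}"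
    using eventually_happens'[OF trivial_limit_at_right_real] by blast
  then show "x = next_arc u"
    using components_nonoverlap x next_arc_component[OF u] by blast
qed

lemma arc_before_next_point:
  assumes u: "u \<in> U"
  shows "(THE x. x \<in> components (S1 - U) \<and> (\<forall>\<^sub>F s in at_left 0. next_point u * cis s \<in> x))
    = next_arc u"
proof (rule the_equality)
  have "next_point u * cis s \<in> next_arc u" if "- gap u < s" "s < 0" for s
    using that by (auto simp: next_arc_def next_point_def mult.assoc cis_mult)
  then have ev: "\<forall>\<^sub>F s in at_left 0. next_point u * cis s \<in> next_arc u"
    using gap_pos[OF u] unfolding eventually_at_left_field
    by (intro exI[of _ "- gap u"]) auto
  then show "next_arc u \<in> components (S1 - U) \<and>
      (\<forall>\<^sub>F s in at_left 0. next_point u * cis s \<in> next_arc u)"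
    using next_arc_component[OF u] by blast
  fix x
  assume x: "x \<in> components (S1 - U) \<and> (\<forall>\<^sub>F s in at_left 0. next_point u * cis s \<in> x)"
  then have "\<forall>\<^sub>F s in at_left 0. next_point u * cis s \<in> x \<inter> next_arc u"
    using ev by (auto elim: eventually_elim2)
  then have "x \<inter> next_arc u \<noteq> {}"
    using eventually_happens'[OF trivial_limit_at_left_real] by blast
  then show "x = next_arc u"
    using components_nonoverlap x next_arc_component[OF u] by blast
qed

end


section \<open>Arcs of a knot diagram\<close>

locale virtual_knot_diagram =
  fixes D :: vdiagram
  assumes knot_diagram: "knot_diagram D"
begin

lemma double_params_finite: "finite (double_params D)"
  and under_double: "under D \<subseteq> double_params D"
  and inj_under: "inj_on (curve D) (under D)"
  and no_triple_point: "\<lbrakk>x \<in> S1; y \<in> S1; z \<in> S1; curve D x = curve D y; curve D y = curve D z\<rbrakk>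
    \<Longrightarrow> x = y \<or> y = z \<or> x = z"
  using knot_diagram unfolding knot_diagram_def by blast+

sublocale circle_points "under D"
proof
  show "finite (under D)"
    using double_params_finite under_double by (rule rev_finite_subset)
  show "under D \<subseteq> S1"
    using under_double by (auto simp: double_params_def)
qed

lemma finite_arcs: "finite (arcs D)"
  and arcs_nonempty: "arcs D \<noteq> {}"
  unfolding arcs_def by (rule finite_components components_nonempty)+

lemma finite_crossings: "finite (crossings D)"
  unfolding crossings_def using finite_points by simp

lemma under_param_curve: "u \<in> under D \<Longrightarrow> under_param D (curve D u) = u"
  unfolding under_param_def using inj_under by (auto simp: inj_on_def)

lemma over_param_in:
  assumes "c \<in> crossings D"
  shows "over_param D c \<in> S1 - under D"
proof -
  obtain u where u: "u \<in> under D" "c = curve D u"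
    using assms by (auto simp: crossings_def)
  then obtain w where w: "w \<in> S1" "w \<noteq> u" "curve D w = c"
    using under_double by (auto simp: double_params_def)
  have wU: "w \<notin> under D"
    using inj_under u w by (auto simp: inj_on_def)
  have "over_param D c = w"
    unfolding over_param_def
  proof (rule the_equality)
    show "w \<in> S1 - under D \<and> curve D w = c" using w wU by blast
    fix z assume z: "z \<in> S1 - under D \<and> curve D z = c"
    moreover have "u \<in> S1" using u points_on_circle by blast
    ultimately show "z = w"
      using no_triple_point[of z w u] w u by auto
  qed
  with w wU show ?thesis by simp
qed

lemma over_arc_in:
  assumes "c \<in> crossings D"
  shows "over_arc D c \<in> arcs D"
proof -
  have "over_param D c \<in> \<Union> (arcs D)"
    using over_param_in[OF assms] by (simp add: arcs_def)
  then obtain x where x: "x \<in> arcs D" "over_param D c \<in> x" by blast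
  then have "over_arc D c = x"
    unfolding over_arc_def arcs_def
    by (intro the_equality) (use components_nonoverlap in blast)+
  with x show ?thesis by simp
qed

lemma under_arc_out_curve: "u \<in> under D \<Longrightarrow> under_arc_out D (curve D u) = next_arc u"
  unfolding under_arc_out_def arcs_def by (simp add: under_param_curve arc_after_point)

lemma under_arc_in_curve:
  "u \<in> under D \<Longrightarrow> under_arc_in D (curve D (next_point u)) = next_arc u"
  unfolding under_arc_in_def arcs_def
  by (simp add: under_param_curve next_point_in arc_before_next_point)

lemma sum_crossings: "(\<Sum>c \<in> crossings D. g c) = (\<Sum>u \<in> under D. g (curve D u))"
  unfolding crossings_def by (simp add: sum.reindex[OF inj_under])

lemma sum_crossings_next:
  "(\<Sum>c \<in> crossings D. g c) = (\<Sum>u \<in> under D. g (curve D (next_point u)))"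
  unfolding sum_crossings by (rule sum.reindex_bij_betw[OF bij_next_point, symmetric])

lemma sum_under_arc_in_eq_out:
  "(\<Sum>c \<in> crossings D. g (under_arc_in D c)) = (\<Sum>c \<in> crossings D. g (under_arc_out D c))"
proof -
  have "(\<Sum>c \<in> crossings D. g (under_arc_in D c)) = (\<Sum>u \<in> under D. g (next_arc u))"
    unfolding sum_crossings_next by (simp add: under_arc_in_curve)
  also have "\<dots> = (\<Sum>c \<in> crossings D. g (under_arc_out D c))"
    unfolding sum_crossings by (simp add: under_arc_out_curve)
  finally show ?thesis .
qed

lemma under_arcs_in:
  assumes "c \<in> crossings D"
  shows "under_arc_in D c \<in> arcs D" and "under_arc_out D c \<in> arcs D"
proof -
  obtain u where u: "u \<in> under D" "c = curve D u"
    using assms by (auto simp: crossings_def)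
  then obtain v where v: "v \<in> under D" "u = next_point v"
    using bij_next_point by (auto simp: bij_betw_def)
  show "under_arc_in D c \<in> arcs D" "under_arc_out D c \<in> arcs D"
    using u v next_arc_component by (auto simp: arcs_def under_arc_in_curve under_arc_out_curve)
qed

lemma arc_induct:
  assumes step: "\<And>c. c \<in> crossings D \<Longrightarrow> P (under_arc_in D c) \<Longrightarrow> P (under_arc_out D c)"
    and "x \<in> arcs D" "P x" "y \<in> arcs D"
  shows "P y"
proof (cases "under D = {}")
  case True
  then have "arcs D = {S1}"
    using components_circle by (simp add: arcs_def)
  with assms show ?thesis by simp
next
  case False
  then have arcs: "arcs D = next_arc ` under D"
    by (simp add: arcs_def components_eq_next_arcs)
  let ?V = "{u \<in> under D. P (next_arc u)}"
  have "?V = under D"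
  proof (rule next_point_transitive)
    show "?V \<noteq> {}" using assms(2,3) by (auto simp: arcs)
    fix u assume u: "u \<in> ?V"
    then have "P (under_arc_out D (curve D (next_point u)))"
      by (intro step) (auto simp: crossings_def next_point_in under_arc_in_curve)
    then show "next_point u \<in> ?V"
      using u by (simp add: under_arc_out_curve next_point_in)
  qed blast
  then show ?thesis using assms(4) by (auto simp: arcs)
qed

lemma right_left_arcs_in:
  assumes "c \<in> crossings D"
  shows "right_arc D c \<in> arcs D" and "left_arc D c \<in> arcs D"
  using under_arcs_in[OF assms] by (simp_all add: right_arc_def left_arc_def)

lemma sum_writhe_left_eq_right:
  fixes g :: "complex set \<Rightarrow> 'b::comm_ring_1"
  shows "(\<Sum>c \<in> crossings D. of_int (writhe D c) * g (left_arc D c)) =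
         (\<Sum>c \<in> crossings D. of_int (writhe D c) * g (right_arc D c))"
proof -
  have "of_int (writhe D c) * g (left_arc D c) - of_int (writhe D c) * g (right_arc D c) =
      g (under_arc_out D c) - g (under_arc_in D c)" for c
    by (simp add: writhe_def left_arc_def right_arc_def)
  then have "(\<Sum>c \<in> crossings D. of_int (writhe D c) * g (left_arc D c)) -
      (\<Sum>c \<in> crossings D. of_int (writhe D c) * g (right_arc D c)) = 0"
    by (simp flip: sum_subtractf) (simp add: sum_subtractf sum_under_arc_in_eq_out)
  then show ?thesis by simp
qed

end


section \<open>Vanishing of the longitude\<close>

lemma sum_fun_apply: "(\<Sum>i \<in> I. f i) x = (\<Sum>i \<in> I. f i x :: 'b::comm_monoid_add)"
  by (induction I rule: infinite_finite_induct) auto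

lemma of_bool_mult_eq: "of_bool b * (r :: laurent) = (if b then r else 0)"
  and mult_of_bool_eq: "(r :: laurent) * of_bool b = (if b then r else 0)"
  by simp_all

interpretation laurent_functions:
  Modules.module "\<lambda>(r :: laurent) (f :: complex set \<Rightarrow> laurent) x. r * f x"
  by unfold_locales (auto simp: algebra_simps fun_eq_iff)

abbreviation basis_vector :: "'x \<Rightarrow> 'x \<Rightarrow> laurent" where
  "basis_vector x \<equiv> \<lambda>y. of_bool (y = x)"

context virtual_knot_diagram
begin

lemma crossing_relation_in:
  assumes "c \<in> crossings D"
  shows "crossing_relation D c \<in> relation_module D"
proof -
  have "rho D (\<lambda>c'. of_bool (c' = c)) = crossing_relation D c"
    using assms finite_crossings by (simp add: rho_def fun_eq_iff of_bool_mult_eq)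
  moreover have "(\<lambda>c'. of_bool (c' = c)) \<in> carrier (free_module (crossings D))"
    using assms by (auto simp: free_module_def)
  ultimately show ?thesis
    unfolding relation_module_def by (metis imageI)
qed

lemma sum_crossing_relation:
  assumes "c \<in> crossings D"
  shows "(\<Sum>x \<in> arcs D. crossing_relation D c x) = 0"
  using assms finite_arcs over_arc_in right_left_arcs_in
  by (simp add: crossing_relation_def sum.distrib sum_subtractf flip: sum_distrib_left)

lemma sum_relation:
  assumes "w \<in> relation_module D"
  shows "(\<Sum>x \<in> arcs D. w x) = 0"
proof -
  obtain f where "w = rho D f"
    using assms by (auto simp: relation_module_def)
  then have "(\<Sum>x \<in> arcs D. w x) =
      (\<Sum>c \<in> crossings D. f c * (\<Sum>x \<in> arcs D. crossing_relation D c x))"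
    by (simp add: rho_def sum_distrib_left) (rule sum.swap)
  then show ?thesis by (simp add: sum_crossing_relation)
qed

lemma subspace_relation_module: "laurent_functions.subspace (relation_module D)"
  unfolding laurent_functions.subspace_def
proof (intro conjI ballI allI)
  have "rho D (\<lambda>c. 0) = 0"
    by (simp add: rho_def fun_eq_iff)
  then show "0 \<in> relation_module D"
    unfolding relation_module_def by (force simp: free_module_def)
  fix v w assume "v \<in> relation_module D" "w \<in> relation_module D"
  then obtain f g where fg: "v = rho D f" "w = rho D g"
    "f \<in> carrier (free_module (crossings D))" "g \<in> carrier (free_module (crossings D))"
    by (auto simp: relation_module_def)
  have "v + w = rho D (\<lambda>c. f c + g c)"
    by (simp add: fg rho_def fun_eq_iff distrib_right sum.distrib)
  moreover have "(\<lambda>c. f c + g c) \<in> carrier (free_module (crossings D))"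
    using fg by (simp add: free_module_def)
  ultimately show "v + w \<in> relation_module D"
    unfolding relation_module_def by blast
next
  fix r v assume "v \<in> relation_module D"
  then obtain f where f: "v = rho D f" "f \<in> carrier (free_module (crossings D))"
    by (auto simp: relation_module_def)
  have "(\<lambda>x. r * v x) = rho D (\<lambda>c. r * f c)"
    by (simp add: f rho_def fun_eq_iff sum_distrib_left mult.assoc)
  moreover have "(\<lambda>c. r * f c) \<in> carrier (free_module (crossings D))"
    using f by (simp add: free_module_def)
  ultimately show "(\<lambda>x. r * v x) \<in> relation_module D"
    unfolding relation_module_def by blast
qed

lemma augmentation_torsion_free:
  assumes outside: "\<And>x. x \<notin> arcs D \<Longrightarrow> v x = 0" and sum: "(\<Sum>x \<in> arcs D. v x) = 0"
    and pv: "(\<lambda>x. (1 - tvar) * v x) \<in> relation_module D"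
  shows "v \<in> relation_module D"
proof -
  let ?W = "relation_module D"
  obtain x\<^sub>0 where x\<^sub>0: "x\<^sub>0 \<in> arcs D" using arcs_nonempty by blast
  let ?S = "(\<lambda>x. basis_vector x - basis_vector x\<^sub>0) ` arcs D"
  have diff: "basis_vector x - basis_vector y \<in> laurent_functions.span ?S"
    if "x \<in> arcs D" "y \<in> arcs D" for x y
  proof -
    have "(basis_vector x - basis_vector x\<^sub>0) - (basis_vector y - basis_vector x\<^sub>0)
        \<in> laurent_functions.span ?S"
      using that by (intro laurent_functions.span_diff laurent_functions.span_base) auto
    then show ?thesis by simp
  qed
  define E where "E x y \<longleftrightarrow> (\<exists>u \<in> laurent_functions.span ?S.
      (basis_vector x - basis_vector y) - (\<lambda>z. (1 - tvar) * u z) \<in> ?W)" for x y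
  have E_sym: "E y x" if xy: "E x y" for x y
  proof -
    obtain u where u: "u \<in> laurent_functions.span ?S"
      "(basis_vector x - basis_vector y) - (\<lambda>z. (1 - tvar) * u z) \<in> ?W"
      using xy unfolding E_def by blast
    have "(basis_vector y - basis_vector x) - (\<lambda>z. (1 - tvar) * (- u) z) =
        - ((basis_vector x - basis_vector y) - (\<lambda>z. (1 - tvar) * u z))"
      by (simp add: fun_eq_iff algebra_simps)
    then have "(basis_vector y - basis_vector x) - (\<lambda>z. (1 - tvar) * (- u) z) \<in> ?W"
      using laurent_functions.subspace_neg[OF subspace_relation_module u(2)] by metis
    then show ?thesis
      unfolding E_def using laurent_functions.span_neg[OF u(1)] by blast
  qed
  have E_trans: "E x z" if xy: "E x y" and yz: "E y z" for x y z
  proof -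
    obtain u u' where u: "u \<in> laurent_functions.span ?S"
      "(basis_vector x - basis_vector y) - (\<lambda>z. (1 - tvar) * u z) \<in> ?W"
      and u': "u' \<in> laurent_functions.span ?S"
      "(basis_vector y - basis_vector z) - (\<lambda>z. (1 - tvar) * u' z) \<in> ?W"
      using xy yz unfolding E_def by blast
    have "(basis_vector x - basis_vector z) - (\<lambda>z. (1 - tvar) * (u + u') z) =
        ((basis_vector x - basis_vector y) - (\<lambda>z. (1 - tvar) * u z)) +
        ((basis_vector y - basis_vector z) - (\<lambda>z. (1 - tvar) * u' z))"
      by (simp add: fun_eq_iff algebra_simps)
    then have "(basis_vector x - basis_vector z) - (\<lambda>z. (1 - tvar) * (u + u') z) \<in> ?W"
      using laurent_functions.subspace_add[OF subspace_relation_module u(2) u'(2)] by metis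
    then show ?thesis
      unfolding E_def using laurent_functions.span_add[OF u(1) u'(1)] by blast
  qed
  have E_crossing: "E (left_arc D c) (right_arc D c)" if c: "c \<in> crossings D" for c
  proof -
    let ?u = "basis_vector (over_arc D c) - basis_vector (right_arc D c)"
    have "(basis_vector (left_arc D c) - basis_vector (right_arc D c)) -
        (\<lambda>z. (1 - tvar) * ?u z) = - crossing_relation D c"
      by (simp add: crossing_relation_def fun_eq_iff algebra_simps)
    then have "(basis_vector (left_arc D c) - basis_vector (right_arc D c)) -
        (\<lambda>z. (1 - tvar) * ?u z) \<in> ?W"
      using laurent_functions.subspace_neg[OF subspace_relation_module crossing_relation_in[OF c]]
      by metis
    then show ?thesis
      unfolding E_def using diff[OF over_arc_in[OF c] right_left_arcs_in(1)[OF c]] by blast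
  qed
  have E_refl: "E x x" for x
    unfolding E_def
    by (rule bexI[of _ 0])
      (simp_all add: laurent_functions.span_zero flip: zero_fun_def,
        simp add: laurent_functions.subspace_0[OF subspace_relation_module])
  have E_all: "E x x\<^sub>0" if "x \<in> arcs D" for x
  proof (rule arc_induct[of "\<lambda>x. E x x\<^sub>0", OF _ x\<^sub>0 E_refl that])
    fix c assume c: "c \<in> crossings D" and E: "E (under_arc_in D c) x\<^sub>0"
    have "E (under_arc_out D c) (under_arc_in D c)"
      using E_crossing[OF c] E_sym by (auto simp: left_arc_def right_arc_def split: if_splits)
    then show "E (under_arc_out D c) x\<^sub>0"
      using E E_trans by blast
  qed
  have "v = (\<Sum>x \<in> arcs D. (\<lambda>z. v x * (basis_vector x - basis_vector x\<^sub>0) z))"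
  proof
    fix z
    have "(\<Sum>x \<in> arcs D. (\<lambda>z. v x * (basis_vector x - basis_vector x\<^sub>0) z)) z =
        (\<Sum>x \<in> arcs D. v x * of_bool (z = x)) - (\<Sum>x \<in> arcs D. v x) * of_bool (z = x\<^sub>0)"
      by (simp add: sum_fun_apply right_diff_distrib sum_subtractf sum_distrib_right)
    also have "\<dots> = v z"
      using finite_arcs outside sum
      by (cases "z \<in> arcs D") (simp_all add: mult_of_bool_eq)
    finally show "v z = (\<Sum>x \<in> arcs D. (\<lambda>z. v x * (basis_vector x - basis_vector x\<^sub>0) z)) z" ..
  qed
  also have "\<dots> \<in> laurent_functions.span ?S"
    by (intro laurent_functions.span_sum laurent_functions.span_scale laurent_functions.span_base
        imageI)
  finally have v: "v \<in> laurent_functions.span ?S" .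
  show ?thesis
  proof (rule laurent_functions.nakayama_torsion_free[OF _ subspace_relation_module _ v pv])
    show "finite ?S" using finite_arcs by simp
    show "\<exists>u \<in> laurent_functions.span ?S. d - (\<lambda>z. (1 - tvar) * u z) \<in> ?W" if "d \<in> ?S" for d
      using that E_all unfolding E_def by blast
  qed
qed


lemma longitude_function_in:
  "(\<lambda>x. of_int (
     (\<Sum>c \<in> crossings D. writhe D c * of_bool (x = over_arc D c))
     - (\<Sum>c \<in> crossings D.
          writhe D c * (of_bool (x = right_arc D c) + of_bool (x = left_arc D c))) div 2))
   \<in> relation_module D" (is "?l \<in> _")
proof -
  let ?w = "\<lambda>c. of_int (writhe D c) :: laurent"
  have l: "?l x = (\<Sum>c \<in> crossings D. ?w c * of_bool (x = over_arc D c))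
      - (\<Sum>c \<in> crossings D. ?w c * of_bool (x = right_arc D c))" for x
  proof -
    have "(\<Sum>c \<in> crossings D. writhe D c * of_bool (x = left_arc D c)) =
        (\<Sum>c \<in> crossings D. writhe D c * of_bool (x = right_arc D c))"
      using sum_writhe_left_eq_right[of "\<lambda>y. of_bool (x = y) :: int"] by simp
    then have "(\<Sum>c \<in> crossings D.
          writhe D c * (of_bool (x = right_arc D c) + of_bool (x = left_arc D c))) div 2 =
        (\<Sum>c \<in> crossings D. writhe D c * of_bool (x = right_arc D c))"
      by (simp add: distrib_left sum.distrib)
    then show ?thesis by simp
  qed
  show ?thesis
  proof (rule augmentation_torsion_free)
    show "?l x = 0" if "x \<notin> arcs D" for x
    proof -
      have "x \<noteq> over_arc D c" "x \<noteq> right_arc D c" if "c \<in> crossings D" for c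
        using that \<open>x \<notin> arcs D\<close> over_arc_in right_left_arcs_in by blast+
      then show ?thesis unfolding l by simp
    qed
    have "(\<Sum>x \<in> arcs D. \<Sum>c \<in> crossings D. ?w c * of_bool (x = g c)) =
        (\<Sum>c \<in> crossings D. ?w c)" if g: "\<And>c. c \<in> crossings D \<Longrightarrow> g c \<in> arcs D" for g
      using finite_arcs g by (subst sum.swap) (simp add: mult_of_bool_eq)
    then show "(\<Sum>x \<in> arcs D. ?l x) = 0"
      unfolding l sum_subtractf using over_arc_in right_left_arcs_in by simp
    have "(1 - tvar) * ?l x = (\<Sum>c \<in> crossings D. ?w c * crossing_relation D c x)" for x
    proof -
      have "(\<Sum>c \<in> crossings D. ?w c * crossing_relation D c x) =
          (1 - tvar) * (\<Sum>c \<in> crossings D. ?w c * of_bool (x = over_arc D c))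
          + tvar * (\<Sum>c \<in> crossings D. ?w c * of_bool (x = right_arc D c))
          - (\<Sum>c \<in> crossings D. ?w c * of_bool (x = left_arc D c))"
        unfolding crossing_relation_def sum_distrib_left sum.distrib[symmetric]
          sum_subtractf[symmetric]
        by (rule sum.cong) (simp_all only: algebra_simps)
      also have "\<dots> = (1 - tvar) * ?l x"
        unfolding l using sum_writhe_left_eq_right[of "\<lambda>y. of_bool (x = y) :: laurent"]
        by (simp add: algebra_simps)
      finally show ?thesis ..
    qed
    moreover have "(\<Sum>c \<in> crossings D. (\<lambda>x. ?w c * crossing_relation D c x))
        \<in> relation_module D"
      using subspace_relation_module crossing_relation_in
      by (intro laurent_functions.subspace_sum laurent_functions.subspace_scale)
    moreover have "(\<Sum>c \<in> crossings D. (\<lambda>x. ?w c * crossing_relation D c x)) =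
        (\<lambda>x. \<Sum>c \<in> crossings D. ?w c * crossing_relation D c x)"
      by (simp add: fun_eq_iff sum_fun_apply)
    ultimately show "(\<lambda>x. (1 - tvar) * ?l x) \<in> relation_module D"
      by (simp only:)
  qed
qed

end


section \<open>The reduced Alexander module\<close>

context virtual_knot_diagram
begin

lemma sigma_eq: "sigma D f = (\<lambda>w. w + f) ` relation_module D"
  by (auto simp: sigma_def a_r_coset_def' free_module_def plus_fun_def)

lemma sigma_eq_iff: "sigma D f = sigma D g \<longleftrightarrow> f - g \<in> relation_module D"
proof
  assume "sigma D f = sigma D g"
  moreover have "f \<in> sigma D f"
    unfolding sigma_eq
    using laurent_functions.subspace_0[OF subspace_relation_module] by force
  ultimately have "f \<in> sigma D g" by simp
  then obtain w where "w \<in> relation_module D" "f = w + g"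
    unfolding sigma_eq by blast
  then show "f - g \<in> relation_module D" by simp
next
  have sub: "sigma D f \<subseteq> sigma D g" if fg: "f - g \<in> relation_module D" for f g
  proof
    fix h assume "h \<in> sigma D f"
    then obtain w where "w \<in> relation_module D" "h = w + f"
      unfolding sigma_eq by blast
    then have "w + (f - g) \<in> relation_module D" "h = (w + (f - g)) + g"
      using laurent_functions.subspace_add[OF subspace_relation_module _ fg] by auto
    then show "h \<in> sigma D g"
      unfolding sigma_eq by blast
  qed
  assume fg: "f - g \<in> relation_module D"
  then have "g - f \<in> relation_module D"
    using laurent_functions.subspace_neg[OF subspace_relation_module fg] by simp
  with fg show "sigma D f = sigma D g"
    using sub by blast
qed

lemma carrier_M_red: "carrier (M_red D) = sigma D ` carrier (free_module (arcs D))"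
  by (auto simp: M_red_def quotient_module_def A_RCOSETS_def' sigma_def)

lemma zero_M_red: "\<zero>\<^bsub>M_red D\<^esub> = sigma D 0"
  by (simp add: M_red_def quotient_module_def sigma_eq)

lemma add_M_red: "sigma D f \<oplus>\<^bsub>M_red D\<^esub> sigma D g = sigma D (f + g)"
proof -
  have "sigma D f \<oplus>\<^bsub>M_red D\<^esub> sigma D g = {a + b | a b. a \<in> sigma D f \<and> b \<in> sigma D g}"
    by (auto simp: M_red_def quotient_module_def set_add_def' free_module_def plus_fun_def)
  also have "\<dots> = sigma D (f + g)"
  proof (intro equalityI subsetI)
    fix h assume "h \<in> {a + b | a b. a \<in> sigma D f \<and> b \<in> sigma D g}"
    then obtain v w where vw: "v \<in> relation_module D" "w \<in> relation_module D"
      "h = (v + f) + (w + g)"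
      unfolding sigma_eq by blast
    then have "v + w \<in> relation_module D" "h = (v + w) + (f + g)"
      using laurent_functions.subspace_add[OF subspace_relation_module]
      by (auto simp: algebra_simps)
    then show "h \<in> sigma D (f + g)"
      unfolding sigma_eq by blast
  next
    fix h assume "h \<in> sigma D (f + g)"
    then obtain w where w: "w \<in> relation_module D" "h = (w + f) + (0 + g)"
      unfolding sigma_eq by (auto simp: algebra_simps)
    then show "h \<in> {a + b | a b. a \<in> sigma D f \<and> b \<in> sigma D g}"
      unfolding sigma_eq using laurent_functions.subspace_0[OF subspace_relation_module] by blast
  qed
  finally show ?thesis .
qed

lemma smult_M_red: "r \<odot>\<^bsub>M_red D\<^esub> sigma D f = sigma D (\<lambda>x. r * f x)"
proof -
  have "r \<odot>\<^bsub>M_red D\<^esub> sigma D f = (\<Union>w \<in> relation_module D. sigma D (\<lambda>x. r * (w + f) x))"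
    by (simp add: M_red_def quotient_module_def sigma_def[symmetric] sigma_eq[of f])
      (simp add: free_module_def sigma_def)
  also have "\<dots> = (\<Union>w \<in> relation_module D. sigma D (\<lambda>x. r * f x))"
  proof (rule SUP_cong[OF refl])
    fix w assume w: "w \<in> relation_module D"
    have "(\<lambda>x. r * (w + f) x) - (\<lambda>x. r * f x) = (\<lambda>x. r * w x)"
      by (simp add: fun_eq_iff algebra_simps)
    then show "sigma D (\<lambda>x. r * (w + f) x) = sigma D (\<lambda>x. r * f x)"
      unfolding sigma_eq_iff
      using laurent_functions.subspace_scale[OF subspace_relation_module w] by simp
  qed
  also have "\<dots> = sigma D (\<lambda>x. r * f x)"
    using laurent_functions.subspace_0[OF subspace_relation_module] by auto
  finally show ?thesis .
qed

lemma phi_sigma: "phi D (sigma D f) = (\<Sum>x \<in> arcs D. f x)"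
proof -
  have "(\<lambda>f. \<Sum>x \<in> arcs D. f x) ` sigma D f = {\<Sum>x \<in> arcs D. f x}"
    unfolding sigma_eq image_image
    using laurent_functions.subspace_0[OF subspace_relation_module]
    by (auto simp: sum.distrib sum_relation)
  then show ?thesis by (simp add: phi_def)
qed

lemma longitude_zero: "longitude D = \<zero>\<^bsub>M_red D\<^esub>"
  unfolding longitude_def zero_M_red sigma_eq_iff using longitude_function_in by simp

lemma zero_in_free_module: "0 \<in> carrier (free_module A)"
  and uminus_in_free_module: "f \<in> carrier (free_module A) \<Longrightarrow> - f \<in> carrier (free_module A)"
  and add_in_free_module: "\<lbrakk>f \<in> carrier (free_module A); g \<in> carrier (free_module A)\<rbrakk>
    \<Longrightarrow> f + g \<in> carrier (free_module A)"
  and smult_in_free_module: "f \<in> carrier (free_module A)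
    \<Longrightarrow> (\<lambda>x. r * f x) \<in> carrier (free_module A)"
  by (simp_all add: free_module_def)

lemma M_red_cases:
  assumes "x \<in> carrier (M_red D)"
  obtains f where "f \<in> carrier (free_module (arcs D))" "x = sigma D f"
  using assms by (auto simp: carrier_M_red)

lemma sigma_in_M_red: "f \<in> carrier (free_module (arcs D)) \<Longrightarrow> sigma D f \<in> carrier (M_red D)"
  by (simp add: carrier_M_red)

lemma module_M_red: "Module.module Laurent (M_red D)"
proof (rule moduleI)
  show "cring Laurent" by (rule cring_from_type_algebra)
  show "abelian_group (M_red D)"
  proof (rule abelian_groupI)
    show "\<zero>\<^bsub>M_red D\<^esub> \<in> carrier (M_red D)"
      by (simp add: zero_M_red sigma_in_M_red zero_in_free_module)
  next
    fix x y assume "x \<in> carrier (M_red D)" "y \<in> carrier (M_red D)"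
    then show "x \<oplus>\<^bsub>M_red D\<^esub> y \<in> carrier (M_red D)" "x \<oplus>\<^bsub>M_red D\<^esub> y = y \<oplus>\<^bsub>M_red D\<^esub> x"
      by (elim M_red_cases;
          simp add: add_M_red sigma_in_M_red add_in_free_module add.commute)+
  next
    fix x y z assume "x \<in> carrier (M_red D)" "y \<in> carrier (M_red D)" "z \<in> carrier (M_red D)"
    then show "x \<oplus>\<^bsub>M_red D\<^esub> y \<oplus>\<^bsub>M_red D\<^esub> z = x \<oplus>\<^bsub>M_red D\<^esub> (y \<oplus>\<^bsub>M_red D\<^esub> z)"
      by (elim M_red_cases) (simp add: add_M_red add.assoc)
  next
    fix x assume "x \<in> carrier (M_red D)"
    then obtain f where f: "f \<in> carrier (free_module (arcs D))" "x = sigma D f"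
      by (rule M_red_cases)
    then show "\<zero>\<^bsub>M_red D\<^esub> \<oplus>\<^bsub>M_red D\<^esub> x = x"
      by (simp add: zero_M_red add_M_red)
    show "\<exists>y \<in> carrier (M_red D). y \<oplus>\<^bsub>M_red D\<^esub> x = \<zero>\<^bsub>M_red D\<^esub>"
      by (rule bexI[of _ "sigma D (- f)"])
        (simp_all add: f add_M_red zero_M_red sigma_in_M_red uminus_in_free_module)
  qed
next
  fix a b :: laurent and x assume "x \<in> carrier (M_red D)"
  then obtain f where f: "f \<in> carrier (free_module (arcs D))" "x = sigma D f"
    by (rule M_red_cases)
  then show "a \<odot>\<^bsub>M_red D\<^esub> x \<in> carrier (M_red D)"
    by (simp add: smult_M_red sigma_in_M_red smult_in_free_module)
  show "(a \<oplus>\<^bsub>Laurent\<^esub> b) \<odot>\<^bsub>M_red D\<^esub> x = a \<odot>\<^bsub>M_red D\<^esub> x \<oplus>\<^bsub>M_red D\<^esub> b \<odot>\<^bsub>M_red D\<^esub> x"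
    by (simp add: f smult_M_red add_M_red plus_fun_def distrib_right)
  show "(a \<otimes>\<^bsub>Laurent\<^esub> b) \<odot>\<^bsub>M_red D\<^esub> x = a \<odot>\<^bsub>M_red D\<^esub> (b \<odot>\<^bsub>M_red D\<^esub> x)"
    by (simp add: f smult_M_red)
  show "\<one>\<^bsub>Laurent\<^esub> \<odot>\<^bsub>M_red D\<^esub> x = x"
    by (simp add: f smult_M_red)
next
  fix a :: laurent and x y assume "x \<in> carrier (M_red D)" "y \<in> carrier (M_red D)"
  then show "a \<odot>\<^bsub>M_red D\<^esub> (x \<oplus>\<^bsub>M_red D\<^esub> y) = a \<odot>\<^bsub>M_red D\<^esub> x \<oplus>\<^bsub>M_red D\<^esub> a \<odot>\<^bsub>M_red D\<^esub> y"
    by (elim M_red_cases) (simp add: smult_M_red add_M_red plus_fun_def distrib_left)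
qed

lemma augmented_M_red:
  assumes "x \<in> arcs D"
  shows "augmented_module (M_red D) (phi D) (sigma D (basis_vector x))"
proof (intro augmented_module.intro augmented_module_axioms.intro module_M_red)
  show "phi D (y \<oplus>\<^bsub>M_red D\<^esub> z) = phi D y + phi D z"
    if "y \<in> carrier (M_red D)" "z \<in> carrier (M_red D)" for y z
    using that by (auto simp: carrier_M_red add_M_red phi_sigma sum.distrib)
  show "phi D (r \<odot>\<^bsub>M_red D\<^esub> y) = r * phi D y" if "y \<in> carrier (M_red D)" for r y
    using that by (auto simp: carrier_M_red smult_M_red phi_sigma sum_distrib_left)
  show "sigma D (basis_vector x) \<in> carrier (M_red D)"
    using assms by (auto simp: carrier_M_red free_module_def)
  show "phi D (sigma D (basis_vector x)) = 1"
    using assms finite_arcs by (simp add: phi_sigma)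
qed

end

theorem theorem12:
  fixes K K' :: "vdiagram set" and D D' :: vdiagram
  assumes "K \<in> virtual_knots" and "K' \<in> virtual_knots"
    and "D \<in> K" and "D' \<in> K'"
  shows "isomorphic_enhanced (M_enr D) (M_enr D') \<longleftrightarrow>
         isomorphic_modules Laurent (ker_phi D) (ker_phi D')"
proof -
  have "knot_diagram D" "knot_diagram D'"
    using assms by (auto simp: virtual_knots_def quotient_def diagram_equiv_def)
  then interpret D: virtual_knot_diagram D + D': virtual_knot_diagram D'
    by unfold_locales
  obtain x x' where "x \<in> arcs D" "x' \<in> arcs D'"
    using D.arcs_nonempty D'.arcs_nonempty by blast
  note aug = D.augmented_M_red[OF this(1)] D'.augmented_M_red[OF this(2)]
  have long: "f (longitude D) = longitude D'"
    if "f \<in> module_isos Laurent (M_red D) (M_red D')" for f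
    using that module_homs_zero[OF D.module_M_red D'.module_M_red]
    by (simp add: D.longitude_zero D'.longitude_zero module_isos_def)
  have "isomorphic_enhanced (M_enr D) (M_enr D') \<longleftrightarrow>
      (\<exists>f \<in> module_isos Laurent (M_red D) (M_red D'). f ` meridians D = meridians D')"
    using long by (auto simp: isomorphic_enhanced_def M_enr_def)
  also have "\<dots> \<longleftrightarrow> isomorphic_modules Laurent (ker_phi D) (ker_phi D')"
    unfolding meridians_def ker_phi_def
    using isomorphic_aug_kernel_if_unit_level_iso[OF aug]
      unit_level_iso_if_isomorphic_aug_kernel[OF aug] by blast
  finally show ?thesis .
qed

end
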